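(* Let $\sigma(A)=(r;\lambda_2,\ldots,\lambda_n)$ be the spectrum of an $n\times n$ nonnegative matrix $A=(a_{ij})$ with Perron eigenvalue $r$. Then there exists a real number $k_A\ge -r$ such that for all real $\varepsilon\ge k_A$, the list $(r+\varepsilon;\lambda_2,\ldots,\lambda_n)$ is the spectrum of a nonnegative $(r+\varepsilon)$-generalized $n\times n$ doubly stochastic matrix $D$.
   Context: A real matrix is nonnegative if all its entries are nonnegative. For a real number $r\ge 0$, a real $n\times n$ matrix (not necessarily nonnegative) is $r$-generalized stochastic if each of its row sums equals $r$, and $r$-generalized doubly stochastic if both it and its transpose are $r$-generalized stochastic. The spectrum of a matrix is the list of its $n$ eigenvalues (possibly complex) counted with multiplicity. Writing the spectrum of a nonnegative matrix as $(\lambda_1;\lambda_2,\ldots,\lambda_n)$, with a semicolon after the first entry, indicates that $\lambda_1$ is the Perron eigenvalue, i.e. the nonnegative eigenvalue that is at least the modulus of every other eigenvalue. *)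

theory Defs
  imports "HOL-Computational_Algebra.Polynomial" "Jordan_Normal_Form.Char_Poly"
begin

definition nonneg_mat :: "real mat \<Rightarrow> bool" where
  "nonneg_mat A \<longleftrightarrow> (\<forall>i < dim_row A. \<forall>j < dim_col A. 0 \<le> A $$ (i, j))"

definition generalized_stochastic :: "real \<Rightarrow> real mat \<Rightarrow> bool" where
  "generalized_stochastic r A \<longleftrightarrow>
     0 \<le> r \<and> square_mat A \<and> (\<forall>i < dim_row A. (\<Sum>j < dim_col A. A $$ (i, j)) = r)"

definition generalized_doubly_stochastic :: "real \<Rightarrow> real mat \<Rightarrow> bool" where
  "generalized_doubly_stochastic r A \<longleftrightarrow>
     generalized_stochastic r A \<and> generalized_stochastic r (transpose_mat A)"

(* The complex eigenvalues of a real square matrix, with algebraic multiplicity. *)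
definition spectrum_mset :: "real mat \<Rightarrow> complex multiset" where
  "spectrum_mset A = proots (char_poly (map_mat complex_of_real A))"

(* The semicolon notation: the spectrum of A is (r; ls) with Perron eigenvalue r.
   The order of the list ls is immaterial, and its length is forced to be n - 1
   for an n x n matrix A. *)
definition has_perron_spectrum :: "real mat \<Rightarrow> real \<Rightarrow> complex list \<Rightarrow> bool" where
  "has_perron_spectrum A r ls \<longleftrightarrow>
     spectrum_mset A = add_mset (complex_of_real r) (mset ls) \<and>
     0 \<le> r \<and> (\<forall>z \<in> set ls. cmod z \<le> r)"

end

(* The spectrum depends only on the characteristic polynomial, and that of A is (x - r) q with
   q = char_poly C for a real matrix C: complete a real eigenvector for r to an orthogonal basis.
   Conversely, complete the all-ones vector to an orthogonal basis, the columns of P, and put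
   D = P diag(r + eps, C) P^-1. Then D = (r + eps)/n J + N with J the all-ones matrix and
   N = P diag(0, C) P^-1. The row and column sums of N vanish and N does not depend on eps, so
   D is nonnegative once eps is large. *)
theory Submission
  imports Defs "Jordan_Normal_Form.Schur_Decomposition"
begin

section \<open>Orthogonal bases with a prescribed first vector\<close>

text \<open>Gram-Schmidt on a basis completion of \<open>v\<close> keeps \<open>v\<close> in front.
  The columns of \<open>P\<close> are then orthogonal, so the rows of its inverse are the same
  vectors rescaled. That row 0 of \<open>Q\<close> is again a multiple of \<open>v\<close> is what
  later controls row sums and column sums at once.\<close>

lemma exists_inverse_pair_with_first_col:
  fixes v :: "real vec"
  assumes v: "v \<in> carrier_vec n" and v0: "v \<noteq> 0\<^sub>v n"
  obtains P Q where "P \<in> carrier_mat n n" "Q \<in> carrier_mat n n"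
    "P * Q = 1\<^sub>m n" "Q * P = 1\<^sub>m n" "col P 0 = v" "row Q 0 = (1 / (v \<bullet> v)) \<cdot>\<^sub>v v"
proof -
  interpret cof_vec_space n "TYPE(real)" .
  have n: "0 < n"
    using v v0 by (metis carrier_vecD gr0I vec_of_dim_0)
  define ws where "ws = gram_schmidt n (basis_completion v)"
  note bc = basis_completion[OF v v0]
  have ws: "set ws \<subseteq> carrier_vec n" "corthogonal ws" "length ws = n"
    using gram_schmidt_result[OF bc(2,4,5) ws_def] bc(6) by auto
  obtain vs where bv: "basis_completion v = v # vs"
    using bc(6,7) n by (cases "basis_completion v") auto
  have "hd ws = v"
    using gram_schmidt_hd[OF v, of vs] unfolding ws_def bv .
  then have ws0: "ws ! 0 = v"
    using ws(3) n by (cases ws) auto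
  define P where "P = mat_of_cols n ws"
  define Q where "Q = mat_of_rows n (map vec_inv ws)"
  have P: "P \<in> carrier_mat n n" and Q: "Q \<in> carrier_mat n n"
    unfolding P_def Q_def using ws by (auto simp: mat_of_rows_def)
  have QP: "Q * P = 1\<^sub>m n"
    using corthogonal_inv[OF ws(2,1)] ws(3) unfolding inverts_mat_def P_def Q_def by simp
  have PQ: "P * Q = 1\<^sub>m n"
    using mat_mult_left_right_inverse[OF Q P QP] .
  have "col P 0 = v"
    unfolding P_def using ws n ws0 v by (simp add: col_mat_of_cols)
  moreover have "row Q 0 = (1 / (v \<bullet> v)) \<cdot>\<^sub>v v"
  proof -
    \<comment> \<open>\<open>vec_inv\<close> conjugates its argument, which is harmless over the
      reals.\<close>
    have "conjugate v = v"
      by (rule eq_vecI) auto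
    then show ?thesis
      unfolding Q_def using ws n ws0 v by (simp add: mat_of_rows_row vec_inv_def)
  qed
  ultimately show thesis
    using that P Q PQ QP by blast
qed

section \<open>Deflation by a real eigenvalue\<close>

lemma char_poly_singleton_mat: "char_poly (mat 1 1 (\<lambda>_. e)) = [:- e, 1:]"
  by (simp add: char_poly_defs det_def sign_def)

lemma mult_mat_unit_vec:
  fixes A :: "'a::comm_semiring_1 mat"
  assumes "A \<in> carrier_mat m n" "i < n"
  shows "A *\<^sub>v unit_vec n i = col A i"
  using assms by (intro eq_vecI) auto

lemma left_inverse_mult_col:
  fixes P Q :: "'a::comm_semiring_1 mat"
  assumes "P \<in> carrier_mat n n" "Q \<in> carrier_mat n n" "Q * P = 1\<^sub>m n" "i < n"
  shows "Q *\<^sub>v col P i = unit_vec n i"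
  by (metis assms carrier_matD(2) col_mult2 col_one)

text \<open>In a basis that starts with an eigenvector for \<open>e\<close>, the first column of the
  matrix is \<open>e\<close> times the first unit vector. The matrix is thus block triangular, and
  \<open>C\<close> is its lower right block.\<close>

lemma char_poly_deflate:
  fixes A :: "real mat"
  assumes A: "A \<in> carrier_mat (Suc m) (Suc m)" and ev: "eigenvalue A e"
  obtains C where "C \<in> carrier_mat m m" "char_poly A = [:- e, 1:] * char_poly C"
proof -
  let ?n = "Suc m"
  obtain v where v: "v \<in> carrier_vec ?n" "v \<noteq> 0\<^sub>v ?n" and Av: "A *\<^sub>v v = e \<cdot>\<^sub>v v"
    using ev A unfolding eigenvalue_def eigenvector_def by auto
  obtain P Q where P: "P \<in> carrier_mat ?n ?n" and Q: "Q \<in> carrier_mat ?n ?n"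
    and PQ: "P * Q = 1\<^sub>m ?n" and QP: "Q * P = 1\<^sub>m ?n" and colP: "col P 0 = v"
    using exists_inverse_pair_with_first_col[OF v] .
  define B where "B = Q * A * P"
  have B: "B \<in> carrier_mat ?n ?n"
    unfolding B_def using P Q A by simp
  have "similar_mat B A"
    by (rule similar_matI[of _ _ Q P ?n]) (use A B P Q PQ QP in \<open>auto simp: B_def\<close>)
  then have cp: "char_poly A = char_poly B"
    by (simp add: char_poly_similar)
  have "col B 0 = (Q * A) *\<^sub>v v"
    unfolding B_def using col_mult2[OF mult_carrier_mat[OF Q A] P, of 0] colP by simp
  also have "\<dots> = Q *\<^sub>v (e \<cdot>\<^sub>v v)"
    using Q A v by (simp add: assoc_mult_mat_vec[of _ ?n ?n _ ?n] Av)
  also have "\<dots> = e \<cdot>\<^sub>v unit_vec ?n 0"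
    using mult_mat_vec[OF Q v(1)] left_inverse_mult_col[OF P Q QP, of 0] colP by simp
  finally have col: "col B 0 = e \<cdot>\<^sub>v unit_vec ?n 0" .
  have entry: "B $$ (i, 0) = (if i = 0 then e else 0)" if "i < ?n" for i
    using arg_cong[OF col, of "\<lambda>w. w $ i"] B that by auto
  obtain B1 B2 B0 B3 where split: "split_block B 1 1 = (B1, B2, B0, B3)"
    by (cases "split_block B 1 1") auto
  have blocks: "B1 \<in> carrier_mat 1 1" "B2 \<in> carrier_mat 1 m" "B3 \<in> carrier_mat m m"
      "B = four_block_mat B1 B2 B0 B3"
    using split_block[OF split, of m m] B by auto
  \<comment> \<open>Only the lower left block \<open>B0\<close> has to vanish; \<open>B2\<close>
    stays arbitrary.\<close>
  have "B1 = mat 1 1 (\<lambda>_. e)" "B0 = 0\<^sub>m m 1"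
    using split[unfolded split_block_def Let_def] B entry by auto
  then have "char_poly B = [:- e, 1:] * char_poly B3"
    using char_poly_four_block_zeros_col[OF blocks(1-3)] blocks(4) char_poly_singleton_mat
    by metis
  with cp blocks(3) show thesis
    using that by metis
qed

section \<open>Realization with constant row and column sums\<close>

lemma index_mult_mat_sum:
  assumes "A \<in> carrier_mat m n" "B \<in> carrier_mat n p" "i < m" "j < p"
  shows "(A * B) $$ (i, j) = (\<Sum>k<n. A $$ (i, k) * B $$ (k, j))"
  using assms by (simp add: scalar_prod_def atLeast0LessThan)

lemma row_sum_eq_mult_mat_vec:
  fixes A :: "real mat"
  assumes "A \<in> carrier_mat m n" "i < m"
  shows "(\<Sum>j<n. A $$ (i, j)) = (A *\<^sub>v vec n (\<lambda>_. 1)) $ i"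
  using assms by (simp add: scalar_prod_def atLeast0LessThan)

text \<open>\<open>Q\<close> sends the first column of \<open>P\<close> to the first unit vector,
  which \<open>B\<close> annihilates. Applied to \<open>N\<close> this yields zero row sums, and
  applied to its transpose zero column sums.\<close>

lemma conjugated_mat_kills_first_col:
  fixes P Q B :: "real mat"
  assumes P: "P \<in> carrier_mat n n" and Q: "Q \<in> carrier_mat n n" and B: "B \<in> carrier_mat n n"
    and n: "0 < n" and QP: "Q * P = 1\<^sub>m n" and col0: "col B 0 = 0\<^sub>v n"
  shows "(P * B * Q) *\<^sub>v col P 0 = 0\<^sub>v n"
proof -
  have v: "col P 0 \<in> carrier_vec n"
    using P by auto
  have "(P * B * Q) *\<^sub>v col P 0 = P *\<^sub>v (B *\<^sub>v (Q *\<^sub>v col P 0))"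
    using P Q B v by (simp add: assoc_mult_mat_vec[of _ n n _ n])
  also have "B *\<^sub>v (Q *\<^sub>v col P 0) = 0\<^sub>v n"
    using left_inverse_mult_col[OF P Q QP n] mult_mat_unit_vec[OF B n] col0 by simp
  also have "P *\<^sub>v 0\<^sub>v n = 0\<^sub>v n"
    using P by auto
  finally show ?thesis .
qed

text \<open>Conjugate diag(s, C) by a basis whose first vector is all-ones. The part carrying
  \<open>s\<close> becomes the constant matrix with entries \<open>s / real n\<close>, and the rest
  is \<open>N\<close>. Since \<open>N\<close> is chosen before \<open>s\<close>, a single bound on
  its entries serves every \<open>s\<close>.\<close>

lemma doubly_stochastic_realization:
  fixes C :: "real mat"
  assumes C: "C \<in> carrier_mat m m"
  defines "n \<equiv> Suc m"
  obtains N where "N \<in> carrier_mat n n"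
    "\<And>i. i < n \<Longrightarrow> (\<Sum>j<n. N $$ (i, j)) = 0"
    "\<And>j. j < n \<Longrightarrow> (\<Sum>i<n. N $$ (i, j)) = 0"
    "\<And>s. char_poly (mat n n (\<lambda>_. s / real n) + N) = [:- s, 1:] * char_poly C"
proof -
  let ?e = "vec n (\<lambda>_. 1) :: real vec"
  have n: "0 < n"
    by (simp add: n_def)
  have e: "?e \<in> carrier_vec n" "?e \<noteq> 0\<^sub>v n"
    using n by (auto dest!: arg_cong[of _ _ "\<lambda>w. w $ 0"])
  have ee: "?e \<bullet> ?e = real n"
    by (simp add: scalar_prod_def)
  obtain P Q where P: "P \<in> carrier_mat n n" and Q: "Q \<in> carrier_mat n n"
    and PQ: "P * Q = 1\<^sub>m n" and QP: "Q * P = 1\<^sub>m n" and colP: "col P 0 = ?e"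
    and rowQ: "row Q 0 = (1 / real n) \<cdot>\<^sub>v ?e"
    using exists_inverse_pair_with_first_col[OF e] ee by metis
  define B where "B = (\<lambda>s. four_block_mat (mat 1 1 (\<lambda>_. s)) (0\<^sub>m 1 m) (0\<^sub>m m 1) C)"
  have B: "B s \<in> carrier_mat n n" for s
    unfolding B_def n_def using C by (auto intro!: carrier_matI)
  define N where "N = P * B 0 * Q"
  have N: "N \<in> carrier_mat n n"
    unfolding N_def using mult_carrier_mat[OF mult_carrier_mat[OF P B] Q] .
  have col0: "col (B 0) 0 = 0\<^sub>v n" "col (B 0)\<^sup>T 0 = 0\<^sub>v n"
    using C unfolding B_def n_def by (auto intro!: eq_vecI)
  have Ne: "N *\<^sub>v ?e = 0\<^sub>v n"
    using conjugated_mat_kills_first_col[OF P Q B n QP col0(1)] colP by (simp add: N_def)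
  \<comment> \<open>Transposition exchanges the roles of \<open>P\<close> and \<open>Q\<close>: the
    conjugating basis is now given by the columns of \<open>Q\<^sup>T\<close>, the first of which is
    again a multiple of all-ones.\<close>
  have NTe: "N\<^sup>T *\<^sub>v ?e = 0\<^sub>v n"
  proof -
    have "N\<^sup>T = Q\<^sup>T * (B 0)\<^sup>T * P\<^sup>T"
      unfolding N_def using P Q B[of 0]
      by (simp add: transpose_mult[of _ n n _ n] assoc_mult_mat[of _ n n _ n _ n])
    moreover have "P\<^sup>T * Q\<^sup>T = 1\<^sub>m n"
      using transpose_mult[OF Q P] QP by simp
    ultimately have "N\<^sup>T *\<^sub>v col Q\<^sup>T 0 = 0\<^sub>v n"
      using conjugated_mat_kills_first_col[of "Q\<^sup>T" n "P\<^sup>T" "(B 0)\<^sup>T"] P Q B n col0(2) by simp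
    moreover have "col Q\<^sup>T 0 = (1 / real n) \<cdot>\<^sub>v ?e"
      using rowQ Q n by simp
    ultimately have "(1 / real n) \<cdot>\<^sub>v (N\<^sup>T *\<^sub>v ?e) = 0\<^sub>v n"
      using mult_mat_vec[of "N\<^sup>T" n n ?e] N e(1) by simp
    then have "(1 / real n) * (N\<^sup>T *\<^sub>v ?e) $ i = 0" if "i < n" for i
      using that N by (metis carrier_matD(1) dim_mult_mat_vec index_smult_vec(1)
          index_transpose_mat(2) carrier_matD(2) index_zero_vec(1))
    then show ?thesis
      using N n by (intro eq_vecI) auto
  qed
  have "char_poly (mat n n (\<lambda>_. s / real n) + N) = [:- s, 1:] * char_poly C" for s
  proof -
    \<comment> \<open>\<open>E\<close> has a single possibly nonzero entry, so
      \<open>P * E * Q\<close> is \<open>s\<close> times the outer product of column 0 of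
      \<open>P\<close> and row 0 of \<open>Q\<close>, whose entries are 1 and
      \<open>1 / real n\<close>.\<close>
    define E where "E = mat n n (\<lambda>(i, j). if i = 0 \<and> j = 0 then s else 0)"
    have E: "E \<in> carrier_mat n n"
      by (simp add: E_def)
    have Bs: "B s = E + B 0"
      unfolding E_def B_def n_def using C by (intro eq_matI) auto
    have "P * E * Q = mat n n (\<lambda>_. s / real n)"
    proof (rule eq_matI)
      fix i j assume "i < dim_row (mat n n (\<lambda>_. s / real n))" "j < dim_col (mat n n (\<lambda>_. s / real n))"
      then have ij: "i < n" "j < n" by auto
      have P1: "P $$ (i, 0) = 1"
        using arg_cong[OF colP, of "\<lambda>w. w $ i"] P ij n by simp
      have Q1: "Q $$ (0, j) = 1 / real n"
        using arg_cong[OF rowQ, of "\<lambda>w. w $ j"] Q ij n by simp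
      have PE: "(P * E) $$ (i, k) = (if k = 0 then s else 0)" if "k < n" for k
      proof -
        have "(P * E) $$ (i, k) = (\<Sum>l<n. P $$ (i, l) * (if l = 0 \<and> k = 0 then s else 0))"
          unfolding index_mult_mat_sum[OF P E ij(1) that] using that by (simp add: E_def)
        also have "\<dots> = (\<Sum>l<n. if l = 0 then (if k = 0 then P $$ (i, 0) * s else 0) else 0)"
          by (intro sum.cong) auto
        also have "\<dots> = (if k = 0 then s else 0)"
          using n P1 by (subst sum.delta) auto
        finally show ?thesis .
      qed
      have "(P * E * Q) $$ (i, j) = (\<Sum>k<n. (P * E) $$ (i, k) * Q $$ (k, j))"
        using index_mult_mat_sum[OF mult_carrier_mat[OF P E] Q ij] .
      also have "\<dots> = (\<Sum>k<n. if k = 0 then s * Q $$ (0, j) else 0)"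
        by (intro sum.cong) (auto simp: PE)
      also have "\<dots> = s / real n"
        using n Q1 by (subst sum.delta) auto
      finally show "(P * E * Q) $$ (i, j) = mat n n (\<lambda>_. s / real n) $$ (i, j)"
        using ij by simp
    qed (use P Q in auto)
    moreover have "P * B s * Q = P * E * Q + N"
      unfolding N_def Bs using P Q E B[of 0]
      by (simp add: mult_add_distrib_mat[of _ n n _ n] add_mult_distrib_mat[of _ n n _ _ n])
    ultimately have D: "mat n n (\<lambda>_. s / real n) + N = P * B s * Q"
      by simp
    have "similar_mat (P * B s * Q) (B s)"
      by (rule similar_matI[of _ _ P Q n]) (use P Q B PQ QP in auto)
    then have "char_poly (P * B s * Q) = char_poly (B s)"
      by (rule char_poly_similar)
    also have "\<dots> = [:- s, 1:] * char_poly C"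
      unfolding B_def char_poly_singleton_mat[symmetric]
      by (rule char_poly_four_block_zeros_col) (use C in auto)
    finally show ?thesis
      unfolding D .
  qed
  moreover have "(\<Sum>j<n. N $$ (i, j)) = 0" if "i < n" for i
    using row_sum_eq_mult_mat_vec[OF N that] Ne that by simp
  moreover have "(\<Sum>i<n. N $$ (i, j)) = 0" if "j < n" for j
  proof -
    have "(\<Sum>i<n. N $$ (i, j)) = (\<Sum>i<n. N\<^sup>T $$ (j, i))"
      using N that by (intro sum.cong) auto
    also have "\<dots> = 0"
      using row_sum_eq_mult_mat_vec[of "N\<^sup>T" n n j] N NTe that by simp
    finally show ?thesis .
  qed
  ultimately show thesis
    using that N by blast
qed

section \<open>From characteristic polynomials to complex spectra\<close>

lemma char_poly_map_of_real:
  assumes "A \<in> carrier_mat n n"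
  shows "char_poly (map_mat complex_of_real A) = map_poly complex_of_real (char_poly A)"
  using of_real_hom.char_poly_hom[OF assms] .

text \<open>The factorization survives the embedding into the complex numbers, and root multisets
  add over products of nonzero polynomials. It serves both to read off the spectrum of
  \<open>C\<close> from \<open>A\<close> and to compute that of \<open>D\<close>.\<close>

lemma spectrum_mset_linear_factor:
  assumes A: "A \<in> carrier_mat n n" and C: "C \<in> carrier_mat m m"
    and cp: "char_poly A = [:- r, 1:] * char_poly C"
  shows "spectrum_mset A = add_mset (complex_of_real r) (spectrum_mset C)"
proof -
  interpret map_poly_comm_ring_hom complex_of_real ..
  have "char_poly (map_mat complex_of_real A)
      = [:- complex_of_real r, 1:] * char_poly (map_mat complex_of_real C)"
    unfolding char_poly_map_of_real[OF A] char_poly_map_of_real[OF C] cp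
    by (simp add: hom_mult map_poly_pCons del: mult_pCons_left)
  moreover have "char_poly (map_mat complex_of_real C) \<noteq> 0"
    using degree_monic_char_poly[of "map_mat complex_of_real C" m] C by auto
  ultimately show ?thesis
    by (simp add: spectrum_mset_def proots_mult del: mult_pCons_left)
qed

text \<open>A real root of the complexified polynomial is a root of the real one, so there is a real
  eigenvector, as deflation within real matrices requires.\<close>

lemma eigenvalue_of_spectrum_mset:
  assumes A: "A \<in> carrier_mat n n" and r: "complex_of_real r \<in># spectrum_mset A"
  shows "eigenvalue A r"
proof -
  have "char_poly (map_mat complex_of_real A) \<noteq> 0"
    using degree_monic_char_poly[of "map_mat complex_of_real A" n] A by auto
  with r have "poly (map_poly complex_of_real (char_poly A)) (complex_of_real r) = 0"
    by (simp add: spectrum_mset_def char_poly_map_of_real[OF A])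
  then show ?thesis
    by (simp add: eigenvalue_root_char_poly[OF A])
qed

section \<open>The threshold and the doubly stochastic matrix\<close>

theorem theorem2p3:
  fixes A :: "real mat" and n :: nat and r :: real and ls :: "complex list"
  assumes "A \<in> carrier_mat n n"
    and "nonneg_mat A"
    and "has_perron_spectrum A r ls"
  shows "\<exists>k. k \<ge> - r \<and>
           (\<forall>\<epsilon> \<ge> k. \<exists>D \<in> carrier_mat n n.
              nonneg_mat D \<and>
              generalized_doubly_stochastic (r + \<epsilon>) D \<and>
              has_perron_spectrum D (r + \<epsilon>) ls)"
proof -
  note A = assms(1)
  have spec: "spectrum_mset A = add_mset (complex_of_real r) (mset ls)" and r: "0 \<le> r"
    and ls: "\<And>z. z \<in> set ls \<Longrightarrow> cmod z \<le> r"
    using assms(3) by (auto simp: has_perron_spectrum_def)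
  have ev: "eigenvalue A r"
    by (rule eigenvalue_of_spectrum_mset[OF A]) (simp add: spec)
  obtain m where n: "n = Suc m"
    using eigenvalue_imp_nonzero_dim[OF A ev] gr0_conv_Suc by auto
  obtain C where C: "C \<in> carrier_mat m m" and cpA: "char_poly A = [:- r, 1:] * char_poly C"
    using char_poly_deflate[OF A[unfolded n] ev] .
  \<comment> \<open>Both descriptions of the spectrum of \<open>A\<close> contain one copy of
    \<open>r\<close>, which cancels.\<close>
  have specC: "spectrum_mset C = mset ls"
    using spectrum_mset_linear_factor[OF A C cpA] spec by simp
  obtain N where N: "N \<in> carrier_mat n n"
    and rows: "\<And>i. i < n \<Longrightarrow> (\<Sum>j<n. N $$ (i, j)) = 0"
    and cols: "\<And>j. j < n \<Longrightarrow> (\<Sum>i<n. N $$ (i, j)) = 0"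
    and cp: "\<And>s. char_poly (mat n n (\<lambda>_. s / real n) + N) = [:- s, 1:] * char_poly C"
    using doubly_stochastic_realization[OF C] unfolding n by metis
  \<comment> \<open>A crude bound on all entries of \<open>N\<close>. The constant
    \<open>s / real n\<close> outweighs it as soon as \<open>s\<close> is at least
    \<open>real n * M\<close>, whence the threshold chosen below.\<close>
  define M where "M = (\<Sum>i<n. \<Sum>j<n. \<bar>N $$ (i, j)\<bar>)"
  have M: "\<bar>N $$ (i, j)\<bar> \<le> M" if "i < n" "j < n" for i j
  proof -
    have "\<bar>N $$ (i, j)\<bar> \<le> (\<Sum>j<n. \<bar>N $$ (i, j)\<bar>)"
      using that by (intro member_le_sum) auto
    also have "\<dots> \<le> M"
      unfolding M_def using that by (intro member_le_sum) (auto intro: sum_nonneg)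
    finally show ?thesis .
  qed
  have M0: "0 \<le> M"
    unfolding M_def by (intro sum_nonneg) auto
  show ?thesis \<comment> \<open>k is nonnegative, so enlarging r keeps it dominant over ls\<close>
  proof (intro exI[of _ "real n * M"] conjI allI impI)
    show "real n * M \<ge> - r"
      using r M0 by (smt (verit) mult_nonneg_nonneg of_nat_0_le_iff)
    fix \<epsilon> :: real assume \<epsilon>: "real n * M \<le> \<epsilon>"
    have \<epsilon>0: "0 \<le> \<epsilon>"
      using \<epsilon> M0 by (smt (verit) mult_nonneg_nonneg of_nat_0_le_iff)
    define s where "s = r + \<epsilon>"
    define D where "D = mat n n (\<lambda>_. s / real n) + N"
    have D: "D \<in> carrier_mat n n" and dims: "dim_row D = n" "dim_col D = n"
      using N by (auto simp: D_def)
    have D_entry: "D $$ (i, j) = s / real n + N $$ (i, j)" if "i < n" "j < n" for i j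
      using N that by (simp add: D_def)
    have "M \<le> s / real n"
      using \<epsilon> r n by (simp add: s_def field_simps)
    then have "nonneg_mat D"
      using M D_entry dims by (fastforce simp: nonneg_mat_def abs_le_iff)
    moreover have "generalized_doubly_stochastic s D"
      using r \<epsilon>0 n dims D_entry rows cols
      by (simp add: generalized_doubly_stochastic_def generalized_stochastic_def s_def
          sum.distrib del: of_nat_Suc)
    moreover have "has_perron_spectrum D s ls"
      \<comment> \<open>\<open>D\<close> shares the factor \<open>char_poly C\<close> with
        \<open>A\<close>, so only the Perron eigenvalue moves, from \<open>r\<close> to
        \<open>s\<close>.\<close>
      using spectrum_mset_linear_factor[OF D C cp[of s, folded D_def]] specC r \<epsilon>0 ls
      by (force simp: has_perron_spectrum_def s_def)
    ultimately show "\<exists>D \<in> carrier_mat n n. nonneg_mat D \<and>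
        generalized_doubly_stochastic (r + \<epsilon>) D \<and> has_perron_spectrum D (r + \<epsilon>) ls"
      using D unfolding s_def by blast
  qed
qed

end
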